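(* Let $\mathcal{P}(X,U)$ be a system of $n$ linear differential polynomial parametric equations $x_i=P_i(U)$, $i=1,\dots,n$, in $n-1$ differential parameters $U=\{u_1,\dots,u_{n-1}\}$ with coefficients in $\mathbb{K}$, and with associated homogeneous linear differential polynomials $H_1,\dots,H_n$. Suppose that $\partial\mathrm{CRes}^h(H_1,\dots,H_n)\neq0$. Then: 1. the system $\mathcal{P}(X,U)$ is proper; 2. furthermore, there exists a set of linear inversion maps $U_1,\dots,U_{n-1}\in\mathbb{K}\{X\}$ for $\mathcal{P}(X,U)$.
   Context: Setting. $\mathbb{K}$ is an ordinary differential field with derivation $\partial$, $n\ge 2$, $X=\{x_1,\dots,x_n\}$ and $U=\{u_1,\dots,u_{n-1}\}$ are sets of differential indeterminates over $\mathbb{K}$; $u_{jk}=\partial^k u_j$. $\mathbb{E}$ is a universal differential extension field of $\mathbb{K}$ containing the indeterminates $U$. $\mathbb{K}\{X\}$, $\mathbb{K}\{U\}$ are the rings of differential polynomials and $\mathbb{K}[\partial]$ is the ring of linear differential operators. A system of linear DPPEs $\mathcal{P}(X,U)$ is $x_i=P_i(U)$, $i=1,\dots,n$, with $P_i\in\mathbb{K}\{U\}$ of degree at most $1$, not all in $\mathbb{K}$. Write $P_i=a_i-\sum_{j=1}^{n-1}\mathcal{L}_{ij}(u_j)$ with $a_i\in\mathbb{K}$, $\mathcal{L}_{ij}\in\mathbb{K}[\partial]$, and put $H_i(U)=\sum_j\mathcal{L}_{ij}(u_j)$. Standing assumption: for each $j$ there is $i$ with $\mathcal{L}_{ij}\ne0$.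 Properness. $\mathrm{ID}=\{f\in\mathbb{K}\{X\}: f(P_1(U),\dots,P_n(U))=0\}$ is the implicit ideal. A generic zero of $\mathrm{ID}$ is a point of $\mathbb{E}^n$ such that the differential polynomials in $\mathbb{K}\{X\}$ vanishing at it are exactly the elements of $\mathrm{ID}$; $(P_1(U),\dots,P_n(U))$ is one. The system is proper if for a generic zero $(\Gamma_1,\dots,\Gamma_n)$ of $\mathrm{ID}$ there exists only one $(\tau_1,\dots,\tau_{n-1})\in\mathbb{E}^{n-1}$ with $\Gamma_i=P_i(\tau_1,\dots,\tau_{n-1})$, $i=1,\dots,n$. Inversion maps for the system are functions $g_1,\dots,g_{n-1}$ of $x_1,\dots,x_n$ and their derivatives such that $u_j=g_j(x_1,\dots,x_n)$, $j=1,\dots,n-1$, whenever $x_i=P_i(U)$ for all $i$; they are linear if they are differential polynomials in $\mathbb{K}\{X\}$ of degree at most 1. Resultant. $\mathrm{ord}(H_i,u_j)$ is the order of $H_i$ in $u_j$, equal to $-1$ if $u_j$ and its derivatives do not occur in $H_i$. $o_i=\max_j\mathrm{ord}(H_i,u_j)$ if $H_i\ne0$ and $o_i=0$ if $H_i=0$; $N=\sum_{i=1}^n o_i$. $\gamma_j=\min\{o_i-\mathrm{ord}(H_i,u_j): i=1,\dots,n\}$, $\gamma=\sum_{j=1}^{n-1}\gamma_j$. Order the derivatives by $u_{jk}<u_{j'k'}$ iff $k<k'$, or $k=k'$ and $j<j'$. Let $L_\gamma^h=\sum_{i=1}^n(N-o_i-\gamma)$. $M(L_\gamma^h)$ is the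 $L_\gamma^h\times L_\gamma^h$ matrix over $\mathbb{K}$ whose rows are the coefficients of $\partial^{N-o_i-\gamma-1}H_i,\dots,\partial H_i,H_i$ (for $i=1,\dots,n$; no rows for $i$ if $N-o_i-\gamma=0$) in the variables $\{u_{jk}: 1\le j\le n-1,\ 0\le k\le N-\gamma_j-\gamma-1\}$ taken in decreasing order. The linear complete differential homogeneous resultant is $\partial\mathrm{CRes}^h(H_1,\dots,H_n)=\det M(L_\gamma^h)$.
   Formalization: Two assumptions are added, without which the matrix is undefined or the claim fails: N−o_i−γ ≥ 0 for every i, and at most one parameter u_j has no column in the matrix, i.e. satisfies N−γ_j−γ−1 < 0. *)

theory Defs
  imports
    "HOL-Library.Poly_Mapping"
    "HOL-Library.FuncSet"
    "HOL-Computational_Algebra.Polynomial"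
    "HOL-Computational_Algebra.Factorial_Ring"
    "Jordan_Normal_Form.Determinant"
begin

section \<open>Differential fields and differential polynomials\<close>

definition derivation :: "('a::comm_ring_1 \<Rightarrow> 'a) \<Rightarrow> bool" where
  "derivation d \<longleftrightarrow> (\<forall>x y. d (x + y) = d x + d y) \<and> (\<forall>x y. d (x * y) = d x * y + x * d y)"

text \<open>
  The pair \<open>(j, k)\<close> stands for the \<open>k\<close>-th derivative of the \<open>j\<close>-th differential indeterminate;
  a differential polynomial is a polynomial (a finitely supported map from monomials to
  coefficients) in these variables. The same type serves for \<open>\<bbbK>{X}\<close> and \<open>\<bbbK>{U}\<close>: they are the
  subrings \<^term>\<open>dpolys n\<close> and \<^term>\<open>dpolys (n - 1)\<close> below.
\<close>

type_synonym dmono = "(nat \<times> nat) \<Rightarrow>\<^sub>0 nat"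
type_synonym 'a dpoly = "dmono \<Rightarrow>\<^sub>0 'a"

definition dconst :: "'a::zero \<Rightarrow> 'a dpoly" where
  "dconst a = Poly_Mapping.single 0 a"

definition dvar :: "nat \<Rightarrow> nat \<Rightarrow> 'a::zero_neq_one dpoly" where
  "dvar j k = Poly_Mapping.single (Poly_Mapping.single (j, k) 1) 1"

definition dvars :: "'a::zero dpoly \<Rightarrow> (nat \<times> nat) set" where
  "dvars p = (\<Union>m\<in>Poly_Mapping.keys p. Poly_Mapping.keys m)"

definition dpolys :: "nat \<Rightarrow> 'a::zero dpoly set" where
  "dpolys m = {p. dvars p \<subseteq> {1..m} \<times> UNIV}"

definition total_degree :: "'a::zero dpoly \<Rightarrow> nat" where
  "total_degree p =
     Max (insert 0 ((\<lambda>m. \<Sum>v\<in>Poly_Mapping.keys m. Poly_Mapping.lookup m v) ` Poly_Mapping.keys p))"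

definition lin_coeff :: "'a::zero dpoly \<Rightarrow> nat \<times> nat \<Rightarrow> 'a" where
  "lin_coeff p v = Poly_Mapping.lookup p (Poly_Mapping.single v 1)"

text \<open>
  The derivation on differential polynomials that extends \<open>d\<close> and maps the variable \<open>(j, k)\<close> to
  \<open>(j, k + 1)\<close>: the first sum differentiates the coefficients, the second one the monomials by the
  Leibniz rule, one factor \<open>v\<close> being replaced by its derivative.
\<close>

definition dp_deriv :: "('a::comm_ring_1 \<Rightarrow> 'a) \<Rightarrow> 'a dpoly \<Rightarrow> 'a dpoly" where
  "dp_deriv d p =
     (\<Sum>m\<in>Poly_Mapping.keys p. Poly_Mapping.single m (d (Poly_Mapping.lookup p m))) +
     (\<Sum>m\<in>Poly_Mapping.keys p. \<Sum>v\<in>Poly_Mapping.keys m.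
        Poly_Mapping.single
          (m - Poly_Mapping.single v 1 + Poly_Mapping.single (fst v, Suc (snd v)) 1)
          (of_nat (Poly_Mapping.lookup m v) * Poly_Mapping.lookup p m))"

text \<open>
  Value of \<open>p\<close> at the point \<open>\<tau>\<close> of a differential ring with derivation \<open>\<delta>\<close>, the coefficients being
  transported along \<open>h\<close>. Taking \<^term>\<open>h = dconst\<close> and \<^term>\<open>\<delta> = dp_deriv d\<close> this is the
  substitution of differential polynomials into \<open>p\<close>.
\<close>

definition deval ::
  "('a::zero \<Rightarrow> 'b::comm_ring_1) \<Rightarrow> ('b \<Rightarrow> 'b) \<Rightarrow> (nat \<Rightarrow> 'b) \<Rightarrow> 'a dpoly \<Rightarrow> 'b" where
  "deval h \<delta> \<tau> p =
     (\<Sum>m\<in>Poly_Mapping.keys p. h (Poly_Mapping.lookup p m) *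
        (\<Prod>v\<in>Poly_Mapping.keys m. ((\<delta> ^^ snd v) (\<tau> (fst v))) ^ Poly_Mapping.lookup m v))"

section \<open>Universal differential extension fields\<close>

definition diff_field_hom ::
  "('k::field \<Rightarrow> 'k) \<Rightarrow> ('e::field \<Rightarrow> 'e) \<Rightarrow> ('k \<Rightarrow> 'e) \<Rightarrow> bool" where
  "diff_field_hom d dE \<iota> \<longleftrightarrow> field_hom \<iota> \<and> (\<forall>x. \<iota> (d x) = dE (\<iota> x))"

definition diff_subfield :: "('e::field \<Rightarrow> 'e) \<Rightarrow> 'e set \<Rightarrow> bool" where
  "diff_subfield dE F \<longleftrightarrow> 0 \<in> F \<and> 1 \<in> F \<and>
     (\<forall>x\<in>F. \<forall>y\<in>F. x + y \<in> F \<and> x * y \<in> F) \<and>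
     (\<forall>x\<in>F. - x \<in> F \<and> inverse x \<in> F \<and> dE x \<in> F)"

definition dpolys_over :: "'e::zero set \<Rightarrow> nat \<Rightarrow> 'e dpoly set" where
  "dpolys_over F m = {p \<in> dpolys m. \<forall>t. Poly_Mapping.lookup p t \<in> F}"

definition prime_diff_ideal ::
  "('e::field \<Rightarrow> 'e) \<Rightarrow> 'e set \<Rightarrow> nat \<Rightarrow> 'e dpoly set \<Rightarrow> bool" where
  "prime_diff_ideal dE F m I \<longleftrightarrow> I \<subseteq> dpolys_over F m \<and> 0 \<in> I \<and> 1 \<notin> I \<and>
     (\<forall>f\<in>I. \<forall>g\<in>I. f + g \<in> I) \<and>
     (\<forall>f\<in>I. \<forall>g\<in>dpolys_over F m. g * f \<in> I) \<and>
     (\<forall>f\<in>I. dp_deriv dE f \<in> I) \<and>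
     (\<forall>f\<in>dpolys_over F m. \<forall>g\<in>dpolys_over F m. f * g \<in> I \<longrightarrow> f \<in> I \<or> g \<in> I)"

text \<open>
  In characteristic \<open>p > 0\<close>, the quotient field of \<open>F{Y}/I\<close> has to be separable over \<open>F\<close>, i.e.
  linearly disjoint from \<open>F\<^sup>1\<^sup>/\<^sup>p\<close>: elements of \<open>F\<close> that are linearly independent over the
  \<open>p\<close>-th powers of \<open>F\<close> stay so over the \<open>p\<close>-th powers of \<open>F{Y}/I\<close>. The condition is void in
  characteristic \<open>0\<close>; without it no universal extension would exist in positive characteristic.
\<close>

definition separable_ideal :: "'e::field set \<Rightarrow> nat \<Rightarrow> 'e dpoly set \<Rightarrow> bool" where
  "separable_ideal F m I \<longleftrightarrow> (CHAR('e) > 0 \<longrightarrow>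
     (\<forall>(r::nat) c f.
        (\<forall>s<r. c s \<in> F \<and> f s \<in> dpolys_over F m) \<longrightarrow>
        (\<forall>b. (\<forall>s<r. b s \<in> F) \<and> (\<Sum>s<r. c s * b s ^ CHAR('e)) = 0 \<longrightarrow> (\<forall>s<r. b s = 0)) \<longrightarrow>
        (\<Sum>s<r. dconst (c s) * f s ^ CHAR('e)) \<in> I \<longrightarrow> (\<forall>s<r. f s \<in> I)))"

text \<open>
  The Ritt--Kolchin notion: over every differential field between \<open>\<bbbK>\<close> and \<open>\<bbbE>\<close> that is finitely
  generated over \<open>\<bbbK>\<close>, every (separable) prime differential ideal in finitely many differential
  indeterminates has a generic zero in \<open>\<bbbE>\<close>. This amounts to the embeddability in \<open>\<bbbE>\<close> of all
  finitely generated (separable) differential field extensions, without a quantification over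
  types.
\<close>

definition universal_extension ::
  "('k::field \<Rightarrow> 'k) \<Rightarrow> ('e::field \<Rightarrow> 'e) \<Rightarrow> ('k \<Rightarrow> 'e) \<Rightarrow> bool" where
  "universal_extension d dE \<iota> \<longleftrightarrow> derivation dE \<and> diff_field_hom d dE \<iota> \<and>
     (\<forall>S m I. finite S \<longrightarrow>
        (let F = diff_subfield dE hull (range \<iota> \<union> S) in
          prime_diff_ideal dE F m I \<longrightarrow> separable_ideal F m I \<longrightarrow>
          (\<exists>\<eta>. \<forall>f\<in>dpolys_over F m. deval id dE \<eta> f = 0 \<longleftrightarrow> f \<in> I)))"

definition diff_alg_independent ::
  "('e::field \<Rightarrow> 'e) \<Rightarrow> ('k::field \<Rightarrow> 'e) \<Rightarrow> nat \<Rightarrow> (nat \<Rightarrow> 'e) \<Rightarrow> bool" where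
  "diff_alg_independent dE \<iota> m u \<longleftrightarrow> (\<forall>f\<in>dpolys m. deval \<iota> dE u f = 0 \<longrightarrow> f = 0)"

section \<open>Linear differential polynomial parametric equations\<close>

definition linear_dppes :: "nat \<Rightarrow> (nat \<Rightarrow> 'k::field dpoly) \<Rightarrow> bool" where
  "linear_dppes n P \<longleftrightarrow>
     (\<forall>i\<in>{1..n}. P i \<in> dpolys (n - 1) \<and> total_degree (P i) \<le> 1) \<and>
     (\<exists>i\<in>{1..n}. P i \<notin> range dconst)"

text \<open>
  A linear differential operator is encoded by its coefficients: the polynomial \<open>A\<close> stands for
  the operator with coefficient \<^term>\<open>coeff A k\<close> at the \<open>k\<close>-th power of the derivation. Only the
  vector space structure of the polynomials is used, as the product of operators is a different one.
\<close>

definition lin_op_var :: "'k::field poly \<Rightarrow> nat \<Rightarrow> 'k dpoly" where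
  "lin_op_var A j = (\<Sum>k\<le>degree A. dconst (coeff A k) * dvar j k)"

definition hom_part :: "nat \<Rightarrow> (nat \<Rightarrow> nat \<Rightarrow> 'k::field poly) \<Rightarrow> nat \<Rightarrow> 'k dpoly" where
  "hom_part n \<L> i = (\<Sum>j\<in>{1..n-1}. lin_op_var (\<L> i j) j)"

definition implicit_ideal ::
  "('k::field \<Rightarrow> 'k) \<Rightarrow> nat \<Rightarrow> (nat \<Rightarrow> 'k dpoly) \<Rightarrow> 'k dpoly set" where
  "implicit_ideal d n P = {f \<in> dpolys n. deval dconst (dp_deriv d) P f = 0}"

definition generic_zero ::
  "('e::field \<Rightarrow> 'e) \<Rightarrow> ('k::field \<Rightarrow> 'e) \<Rightarrow> nat \<Rightarrow> 'k dpoly set \<Rightarrow> (nat \<Rightarrow> 'e) \<Rightarrow> bool" where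
  "generic_zero dE \<iota> n I \<Gamma> \<longleftrightarrow> {f \<in> dpolys n. deval \<iota> dE \<Gamma> f = 0} = I"

definition proper_dppes ::
  "('k::field \<Rightarrow> 'k) \<Rightarrow> ('e::field \<Rightarrow> 'e) \<Rightarrow> ('k \<Rightarrow> 'e) \<Rightarrow> nat \<Rightarrow> (nat \<Rightarrow> 'k dpoly) \<Rightarrow> bool" where
  "proper_dppes d dE \<iota> n P \<longleftrightarrow>
     (\<forall>\<Gamma>. generic_zero dE \<iota> n (implicit_ideal d n P) \<Gamma> \<longrightarrow>
        (\<exists>!\<tau>. \<tau> \<in> {1..n-1} \<rightarrow>\<^sub>E UNIV \<and> (\<forall>i\<in>{1..n}. \<Gamma> i = deval \<iota> dE \<tau> (P i))))"

definition linear_inversion_maps ::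
  "('k::field \<Rightarrow> 'k) \<Rightarrow> nat \<Rightarrow> (nat \<Rightarrow> 'k dpoly) \<Rightarrow> (nat \<Rightarrow> 'k dpoly) \<Rightarrow> bool" where
  "linear_inversion_maps d n P g \<longleftrightarrow>
     (\<forall>j\<in>{1..n-1}. g j \<in> dpolys n \<and> total_degree (g j) \<le> 1 \<and>
        deval dconst (dp_deriv d) P (g j) = dvar j 0)"

section \<open>The linear complete differential homogeneous resultant\<close>

definition ord_in :: "'k::zero dpoly \<Rightarrow> nat \<Rightarrow> int" where
  "ord_in p j = (if \<exists>k. (j, k) \<in> dvars p then int (Max {k. (j, k) \<in> dvars p}) else -1)"

definition max_ord :: "nat \<Rightarrow> 'k::zero dpoly \<Rightarrow> int" where
  "max_ord n p = (if p = 0 then 0 else Max (ord_in p ` {1..n-1}))"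

definition ord_sum :: "nat \<Rightarrow> (nat \<Rightarrow> 'k::zero dpoly) \<Rightarrow> int" where
  "ord_sum n H = (\<Sum>i\<in>{1..n}. max_ord n (H i))"

definition gamma_at :: "nat \<Rightarrow> (nat \<Rightarrow> 'k::zero dpoly) \<Rightarrow> nat \<Rightarrow> int" where
  "gamma_at n H j = Min ((\<lambda>i. max_ord n (H i) - ord_in (H i) j) ` {1..n})"

definition gamma_sum :: "nat \<Rightarrow> (nat \<Rightarrow> 'k::zero dpoly) \<Rightarrow> int" where
  "gamma_sum n H = (\<Sum>j\<in>{1..n-1}. gamma_at n H j)"

text \<open>
  \<open>row_count n H i\<close> is the number of rows coming from \<open>H i\<close>, and \<open>col_count n H j\<close> the number of
  columns belonging to \<open>u\<^sub>j\<close> and its derivatives, whenever these integers are nonnegative.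
\<close>

definition row_count :: "nat \<Rightarrow> (nat \<Rightarrow> 'k::zero dpoly) \<Rightarrow> nat \<Rightarrow> int" where
  "row_count n H i = ord_sum n H - max_ord n (H i) - gamma_sum n H"

definition col_count :: "nat \<Rightarrow> (nat \<Rightarrow> 'k::zero dpoly) \<Rightarrow> nat \<Rightarrow> int" where
  "col_count n H j = ord_sum n H - gamma_at n H j - gamma_sum n H"

text \<open>The row \<open>(i, k)\<close> is that of the \<open>k\<close>-th derivative of \<open>H i\<close>.\<close>

definition res_rows :: "nat \<Rightarrow> (nat \<Rightarrow> 'k::zero dpoly) \<Rightarrow> (nat \<times> nat) list" where
  "res_rows n H = [(i, k). i \<leftarrow> [1..<Suc n], k \<leftarrow> rev [0..<nat (row_count n H i)]]"

text \<open>
  The variables by decreasing order of derivation and then decreasing index. The bound on \<open>k\<close> in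
  the generator loses nothing, as all the numbers \<^term>\<open>gamma_at n H j\<close> are nonnegative.
\<close>

definition res_cols :: "nat \<Rightarrow> (nat \<Rightarrow> 'k::zero dpoly) \<Rightarrow> (nat \<times> nat) list" where
  "res_cols n H =
     [(j, k). k \<leftarrow> rev [0..<nat (ord_sum n H)], j \<leftarrow> rev [1..<n], int k \<le> col_count n H j - 1]"

definition res_size :: "nat \<Rightarrow> (nat \<Rightarrow> 'k::zero dpoly) \<Rightarrow> nat" where
  "res_size n H = nat (\<Sum>i\<in>{1..n}. row_count n H i)"

definition res_matrix ::
  "('k::field \<Rightarrow> 'k) \<Rightarrow> nat \<Rightarrow> (nat \<Rightarrow> 'k dpoly) \<Rightarrow> 'k mat" where
  "res_matrix d n H = mat (res_size n H) (res_size n H)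
     (\<lambda>(r, c). case res_rows n H ! r of (i, k) \<Rightarrow>
        lin_coeff ((dp_deriv d ^^ k) (H i)) (res_cols n H ! c))"

text \<open>
  This is the determinant of the intended square matrix if all the row counts are nonnegative, since
  then \<^term>\<open>res_size n H\<close> is the number of rows as well as of columns. If that number is \<open>0\<close>, the
  value is \<open>1\<close>. A parameter with column count \<open>0\<close> does not occur in the matrix at all.
\<close>

definition dCRes_h :: "('k::field \<Rightarrow> 'k) \<Rightarrow> nat \<Rightarrow> (nat \<Rightarrow> 'k dpoly) \<Rightarrow> 'k" where
  "dCRes_h d n H = det (res_matrix d n H)"

end

theory Submission
  imports Defs
begin

text \<open>
  Let \<open>R\<close> be the set of differential polynomials in \<open>U\<close> that arise from polynomials in
  \<open>\<bbbK>{X}\<close> of degree at most 1 by the substitution \<open>X = P(U)\<close>. As substitution commutes with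
  the derivation, \<open>R\<close> is a \<open>\<bbbK>\<close>-vector space closed under the derivation. It contains the
  constants and the \<open>P\<^sub>i\<close>, and so the \<open>H\<^sub>i = a\<^sub>i - P\<^sub>i\<close> with all their derivatives.
  Linear inversion maps exist as soon as every parameter \<open>u\<^sub>j\<close> lies in \<open>R\<close>
  (\<open>recoverable_parameters\<close>).

  The definition of the \<open>\<gamma>\<^sub>j\<close> makes the column bounds wide enough for the rows: an \<open>H\<^sub>i\<close> is
  differentiated fewer than \<open>N - o\<^sub>i - \<gamma>\<close> times, so its derivatives have order at most
  \<open>N - \<gamma>\<^sub>j - \<gamma> - 1\<close> in \<open>u\<^sub>j\<close> (\<open>order_plus_row_count_le_col_count\<close>). Hence a row of
  \<open>M(L)\<close> lists all coefficients of the form it stands for, and there are as many rows as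
  columns. If the determinant does not vanish, the rows span the whole row space, so each variable
  \<open>u\<^sub>j\<^sub>k\<close> heading a column is a \<open>\<bbbK>\<close>-linear combination of derivatives of the \<open>H\<^sub>i\<close>
  (\<open>coordinate_as_combination_of_forms\<close>). This puts \<open>u\<^sub>j\<close> in \<open>R\<close> whenever it has a column.

  A parameter \<open>u\<^sub>j\<close> without a column occurs in some \<open>H\<^sub>i\<close>, and the same order bound forces it
  to occur there with order 0 only, that is, as \<open>c u\<^sub>j\<close> with \<open>c \<noteq> 0\<close>. There is at most one such
  parameter, so all others have columns, hence lie in \<open>R\<close>, and solving \<open>H\<^sub>i\<close> for \<open>u\<^sub>j\<close> puts
  \<open>u\<^sub>j\<close> in \<open>R\<close> as well.

  Inversion maps \<open>g\<^sub>j\<close> give properness (\<open>proper_if_inversion_maps\<close>). A point \<open>\<tau>\<close> with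
  \<open>P(\<tau>) = \<Gamma>\<close> has to be \<open>g(\<Gamma>)\<close>; and the polynomial \<open>x\<^sub>i - P\<^sub>i(g)\<close> is in the implicit ideal,
  so it vanishes at the generic zero \<open>\<Gamma>\<close>, which says that \<open>g(\<Gamma>)\<close> is indeed such a point.
\<close>

section \<open>Differential polynomials of degree at most 1\<close>

definition supported_on :: "dmono set \<Rightarrow> 'a::zero dpoly set" where
  "supported_on M = {p. Poly_Mapping.keys p \<subseteq> M}"

definition var_monos :: "(nat \<times> nat) set \<Rightarrow> dmono set" where
  "var_monos V = (\<lambda>v. Poly_Mapping.single v 1) ` V"

abbreviation linear_forms :: "(nat \<times> nat) set \<Rightarrow> 'a::zero dpoly set" where
  "linear_forms V \<equiv> supported_on (var_monos V)"

definition affine_forms :: "nat \<Rightarrow> 'a::zero dpoly set" where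
  "affine_forms m = supported_on (insert 0 (var_monos ({1..m} \<times> UNIV)))"

lemma var_monos_mono: "V \<subseteq> W \<Longrightarrow> var_monos V \<subseteq> var_monos W"
  unfolding var_monos_def by (rule image_mono)

lemma supported_on_mono: "M \<subseteq> N \<Longrightarrow> supported_on M \<subseteq> supported_on N"
  unfolding supported_on_def by auto

lemma zero_supported [simp]: "0 \<in> supported_on M"
  by (simp add: supported_on_def)

lemma single_supported: "m \<in> M \<Longrightarrow> Poly_Mapping.single m c \<in> supported_on M"
  by (simp add: supported_on_def)

lemma dconst_supported: "0 \<in> M \<Longrightarrow> dconst c \<in> supported_on M"
  by (simp add: dconst_def single_supported)

lemma dvar_supported: "(j, k) \<in> V \<Longrightarrow> dvar j k \<in> linear_forms V"
  by (simp add: dvar_def single_supported var_monos_def)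

lemma add_supported:
  "p \<in> supported_on M \<Longrightarrow> q \<in> supported_on M \<Longrightarrow> p + q \<in> supported_on M"
  for p :: "'a::comm_monoid_add dpoly"
  unfolding supported_on_def using Poly_Mapping.keys_add[of p q] by blast

lemma diff_supported:
  "p \<in> supported_on M \<Longrightarrow> q \<in> supported_on M \<Longrightarrow> p - q \<in> supported_on M"
  for p :: "'a::ab_group_add dpoly"
  unfolding supported_on_def using keys_diff[of p q] by blast

lemma sum_supported:
  "(\<And>i. i \<in> I \<Longrightarrow> f i \<in> supported_on M) \<Longrightarrow> sum f I \<in> supported_on M"
  for f :: "'b \<Rightarrow> 'a::comm_monoid_add dpoly"
  by (induction I rule: infinite_finite_induct) (auto intro: add_supported)

lemma supported_induct [consumes 1, case_names zero single add]:
  fixes p :: "'a::comm_monoid_add dpoly"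
  assumes "p \<in> supported_on M" and "Q 0"
    and "\<And>m c. m \<in> M \<Longrightarrow> Q (Poly_Mapping.single m c)"
    and "\<And>p q. Q p \<Longrightarrow> Q q \<Longrightarrow> Q (p + q)"
  shows "Q p"
proof -
  have "p = (\<Sum>m\<in>Poly_Mapping.keys p. Poly_Mapping.single m (Poly_Mapping.lookup p m))"
    by (rule poly_mapping_eqI) (auto simp: lookup_sum lookup_single when_def in_keys_iff sum.delta')
  moreover have "Q (\<Sum>m\<in>K. Poly_Mapping.single m (Poly_Mapping.lookup p m))" if "K \<subseteq> M" for K
    using that by (induction K rule: infinite_finite_induct) (auto intro: assms)
  ultimately show ?thesis
    using assms(1) by (metis (no_types, lifting) mem_Collect_eq supported_on_def)
qed

lemma supported_UNIV: "p \<in> supported_on UNIV"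
  by (simp add: supported_on_def)

lemma dconst_single: "dconst c * Poly_Mapping.single m b = Poly_Mapping.single m (c * b)"
  by (simp add: dconst_def mult_single)

lemma dconst_0 [simp]: "dconst 0 = 0" by (simp add: dconst_def)
lemma dconst_1 [simp]: "dconst 1 = 1" by (simp add: dconst_def)
lemma dconst_add: "dconst (a + b) = dconst a + dconst b" by (simp add: dconst_def single_add)
lemma dconst_mult: "dconst (a * b) = dconst a * dconst b" by (simp add: dconst_def mult_single)

lemma scale_supported:
  "p \<in> supported_on M \<Longrightarrow> dconst c * p \<in> supported_on M"
  for p :: "'a::comm_ring_1 dpoly"
  by (induction rule: supported_induct)
     (auto simp: dconst_single distrib_left intro: single_supported add_supported)

lemma dvar_term: "dconst c * dvar j k = Poly_Mapping.single (Poly_Mapping.single (j, k) 1) c"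
  for c :: "'a::comm_ring_1"
  by (simp add: dvar_def dconst_single)

lemma linear_induct [consumes 1, case_names zero variable add]:
  fixes p :: "'a::comm_ring_1 dpoly"
  assumes "p \<in> linear_forms V" and "Q 0"
    and "\<And>j k c. (j, k) \<in> V \<Longrightarrow> Q (dconst c * dvar j k)"
    and "\<And>p q. Q p \<Longrightarrow> Q q \<Longrightarrow> Q (p + q)"
  shows "Q p"
  using assms by (induction rule: supported_induct) (auto simp: var_monos_def dvar_term)

lemma affine_induct [consumes 1, case_names const variable add]:
  fixes p :: "'a::comm_ring_1 dpoly"
  assumes "p \<in> affine_forms m" and const: "\<And>c. Q (dconst c)"
    and "\<And>j k c. j \<in> {1..m} \<Longrightarrow> Q (dconst c * dvar j k)"
    and "\<And>p q. Q p \<Longrightarrow> Q q \<Longrightarrow> Q (p + q)"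
  shows "Q p"
  using assms(1) unfolding affine_forms_def
proof (induction rule: supported_induct)
  case zero
  then show ?case using const[of 0] by simp
next
  case (single t c)
  then show ?case using const[of c] assms(3)
    by (auto simp: var_monos_def dvar_term simp flip: dconst_def simp del: One_nat_def)
qed (rule assms(4))

lemma dconst_affine: "dconst c \<in> affine_forms m"
  by (simp add: affine_forms_def dconst_supported)

lemma dvar_affine: "j \<in> {1..m} \<Longrightarrow> dvar j k \<in> affine_forms m"
  unfolding affine_forms_def
  by (rule subsetD[OF supported_on_mono dvar_supported[of _ _ "{1..m} \<times> UNIV"]]) auto

lemma add_affine: "p \<in> affine_forms m \<Longrightarrow> q \<in> affine_forms m \<Longrightarrow> p + q \<in> affine_forms m"
  for p :: "'a::comm_ring_1 dpoly"
  unfolding affine_forms_def by (rule add_supported)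

lemma diff_affine: "p \<in> affine_forms m \<Longrightarrow> q \<in> affine_forms m \<Longrightarrow> p - q \<in> affine_forms m"
  for p :: "'a::comm_ring_1 dpoly"
  unfolding affine_forms_def by (rule diff_supported)

lemma scale_affine: "p \<in> affine_forms m \<Longrightarrow> dconst c * p \<in> affine_forms m"
  for p :: "'a::comm_ring_1 dpoly"
  unfolding affine_forms_def by (rule scale_supported)

lemma affine_dpolys: "p \<in> affine_forms m \<Longrightarrow> p \<in> dpolys m"
  unfolding affine_forms_def dpolys_def dvars_def supported_on_def var_monos_def by fastforce

lemma total_degree_affine: "p \<in> affine_forms m \<Longrightarrow> total_degree p \<le> 1"
  unfolding affine_forms_def total_degree_def supported_on_def var_monos_def
  by (auto 0 3 simp: lookup_single)

lemma single_one_eq_iff: "Poly_Mapping.single v (1::nat) = Poly_Mapping.single w 1 \<longleftrightarrow> v = w"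
  by (metis lookup_single_eq lookup_single_not_eq zero_neq_one)

lemma linear_form_expansion:
  fixes p :: "'a::comm_ring_1 dpoly"
  assumes "p \<in> linear_forms V" and "finite V"
  shows "p = (\<Sum>(j, k)\<in>V. dconst (lin_coeff p (j, k)) * dvar j k)"
proof (rule poly_mapping_eqI)
  fix m
  have "Poly_Mapping.lookup (\<Sum>(j, k)\<in>V. dconst (lin_coeff p (j, k)) * dvar j k) m =
      (\<Sum>v\<in>V. if m = Poly_Mapping.single v 1 then Poly_Mapping.lookup p (Poly_Mapping.single v 1) else 0)"
    by (auto simp: lookup_sum dvar_def dconst_single lookup_single lin_coeff_def when_def
        case_prod_unfold intro!: sum.cong)
  also have "\<dots> = Poly_Mapping.lookup p m"
  proof (cases "m \<in> var_monos V")
    case True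
    then obtain v where v: "v \<in> V" "m = Poly_Mapping.single v 1" by (auto simp: var_monos_def)
    then show ?thesis using \<open>finite V\<close> by (simp add: single_one_eq_iff sum.delta' del: One_nat_def)
  next
    case False
    then have "Poly_Mapping.lookup p m = 0"
      using assms(1) by (auto simp: supported_on_def in_keys_iff)
    then show ?thesis using False by (auto simp: var_monos_def intro!: sum.neutral)
  qed
  finally show "Poly_Mapping.lookup p m =
    Poly_Mapping.lookup (\<Sum>(j, k)\<in>V. dconst (lin_coeff p (j, k)) * dvar j k) m" by simp
qed

section \<open>The derivation on differential polynomials\<close>

lemma derivation_add: "derivation d \<Longrightarrow> d (x + y) = d x + d y"
  and derivation_mult: "derivation d \<Longrightarrow> d (x * y) = d x * y + x * d y"
  by (auto simp: derivation_def)

lemma derivation_0: "derivation d \<Longrightarrow> d 0 = 0"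
  by (metis add_cancel_right_right derivation_add)

text \<open>
  With a support set that may be larger than the set of keys, the defining sums of two polynomials
  range over the same set, which is what additivity needs.
\<close>

lemma dp_deriv_superset:
  assumes "derivation d" "finite K" "Poly_Mapping.keys p \<subseteq> K"
  shows "dp_deriv d p =
     (\<Sum>m\<in>K. Poly_Mapping.single m (d (Poly_Mapping.lookup p m))) +
     (\<Sum>m\<in>K. \<Sum>v\<in>Poly_Mapping.keys m.
        Poly_Mapping.single
          (m - Poly_Mapping.single v 1 + Poly_Mapping.single (fst v, Suc (snd v)) 1)
          (of_nat (Poly_Mapping.lookup m v) * Poly_Mapping.lookup p m))"
  unfolding dp_deriv_def
  by (intro arg_cong2[where f = "(+)"] sum.mono_neutral_left)
     (use assms in \<open>auto simp: in_keys_iff derivation_0\<close>)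

lemma dp_deriv_add:
  assumes "derivation d"
  shows "dp_deriv d (p + q) = dp_deriv d p + dp_deriv d q"
proof -
  let ?K = "Poly_Mapping.keys p \<union> Poly_Mapping.keys q"
  have *: "finite ?K" "Poly_Mapping.keys (p + q) \<subseteq> ?K" "Poly_Mapping.keys p \<subseteq> ?K" "Poly_Mapping.keys q \<subseteq> ?K"
    using Poly_Mapping.keys_add[of p q] by auto
  show ?thesis
    unfolding *(2-)[THEN dp_deriv_superset[OF assms *(1)]]
    by (simp add: lookup_add derivation_add[OF assms] single_add distrib_left sum.distrib algebra_simps)
qed

lemma dp_deriv_single:
  assumes "derivation d"
  shows "dp_deriv d (Poly_Mapping.single m c) = Poly_Mapping.single m (d c) +
     (\<Sum>v\<in>Poly_Mapping.keys m.
        Poly_Mapping.single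
          (m - Poly_Mapping.single v 1 + Poly_Mapping.single (fst v, Suc (snd v)) 1)
          (of_nat (Poly_Mapping.lookup m v) * c))"
  by (subst dp_deriv_superset[OF assms, where K = "{m}"]) auto

lemma dp_deriv_0: "dp_deriv d 0 = 0"
  by (simp add: dp_deriv_def)

lemma dp_deriv_dconst: "derivation d \<Longrightarrow> dp_deriv d (dconst c) = dconst (d c)"
  by (simp add: dconst_def dp_deriv_single)

lemma dp_deriv_scale:
  assumes "derivation d"
  shows "dp_deriv d (dconst c * p) = dconst (d c) * p + dconst c * dp_deriv d p"
  using supported_UNIV[of p]
proof (induction rule: supported_induct)
  case zero
  then show ?case using assms by (simp add: dp_deriv_0)
next
  case (single m b)
  then show ?case using assms
    by (simp add: dp_deriv_single dconst_single derivation_mult single_add distrib_left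
      sum_distrib_left mult.left_commute algebra_simps)
next
  case (add p q)
  then show ?case using assms by (simp add: dp_deriv_add distrib_left algebra_simps)
qed

lemma derivation_1: "derivation d \<Longrightarrow> d 1 = 0"
  using derivation_mult[of d 1 1] by simp

lemma dp_deriv_dvar: "derivation d \<Longrightarrow> dp_deriv d (dvar j k) = dvar j (Suc k)"
  by (simp add: dvar_def dp_deriv_single derivation_1)

lemma dp_deriv_pow_dvar: "derivation d \<Longrightarrow> (dp_deriv d ^^ k) (dvar j 0) = dvar j k"
  by (induction k) (auto simp: dp_deriv_dvar)

lemma dp_deriv_linear:
  assumes "derivation d" "p \<in> linear_forms V" "\<And>j k. (j, k) \<in> V \<Longrightarrow> (j, k) \<in> W \<and> (j, Suc k) \<in> W"
  shows "dp_deriv d p \<in> linear_forms W"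
  using assms(2)
  by (induction rule: linear_induct)
     (use assms in \<open>auto simp: dp_deriv_0 dp_deriv_add dp_deriv_scale dp_deriv_dvar
        intro!: add_supported scale_supported dvar_supported\<close>)

lemma dp_deriv_affine:
  assumes "derivation d" "p \<in> affine_forms m"
  shows "dp_deriv d p \<in> affine_forms m"
  using assms(2)
  by (induction rule: affine_induct)
     (use assms in \<open>auto simp: dp_deriv_dconst dp_deriv_add dp_deriv_scale dp_deriv_dvar
        intro!: add_affine scale_affine dvar_affine dconst_affine\<close>)

lemma dp_deriv_pow_affine:
  "derivation d \<Longrightarrow> p \<in> affine_forms m \<Longrightarrow> (dp_deriv d ^^ k) p \<in> affine_forms m"
  by (induction k) (auto simp: dp_deriv_affine)

section \<open>Evaluation and substitution\<close>

text \<open>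
  Both kinds of evaluation are covered: at points of an extension field, with \<open>h\<close> its embedding,
  and the substitution of differential polynomials, with \<open>h\<close> the inclusion of the constants.
  The Leibniz rule is demanded only for products with a scalar, which is all that polynomials of
  degree at most 1 involve.
\<close>

locale diff_algebra =
  fixes d :: "'a::comm_ring_1 \<Rightarrow> 'a" and h :: "'a \<Rightarrow> 'b::comm_ring_1" and \<delta> :: "'b \<Rightarrow> 'b"
  assumes d: "derivation d"
    and h_add: "h (x + y) = h x + h y"
    and h_mult: "h (x * y) = h x * h y"
    and h_1: "h 1 = 1"
    and \<delta>_add: "\<delta> (a + b) = \<delta> a + \<delta> b"
    and \<delta>_h: "\<delta> (h x) = h (d x)"
    and \<delta>_scale: "\<delta> (h x * a) = h (d x) * a + h x * \<delta> a"
begin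

lemma h_0: "h 0 = 0" using h_add[of 0 0] by simp

lemma deval_superset:
  assumes "finite K" "Poly_Mapping.keys p \<subseteq> K"
  shows "deval h \<delta> \<tau> p = (\<Sum>m\<in>K. h (Poly_Mapping.lookup p m) *
        (\<Prod>v\<in>Poly_Mapping.keys m. ((\<delta> ^^ snd v) (\<tau> (fst v))) ^ Poly_Mapping.lookup m v))"
  unfolding deval_def
  by (rule sum.mono_neutral_left) (use assms in \<open>auto simp: in_keys_iff h_0\<close>)

lemma deval_add: "deval h \<delta> \<tau> (p + q) = deval h \<delta> \<tau> p + deval h \<delta> \<tau> q"
proof -
  let ?K = "Poly_Mapping.keys p \<union> Poly_Mapping.keys q"
  have *: "finite ?K" "Poly_Mapping.keys (p + q) \<subseteq> ?K" "Poly_Mapping.keys p \<subseteq> ?K" "Poly_Mapping.keys q \<subseteq> ?K"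
    using Poly_Mapping.keys_add[of p q] by auto
  show ?thesis
    unfolding *(2-)[THEN deval_superset[OF *(1)]]
    by (simp add: lookup_add h_add distrib_right sum.distrib)
qed

lemma deval_0: "deval h \<delta> \<tau> 0 = 0" by (simp add: deval_def)

lemma deval_diff: "deval h \<delta> \<tau> (p - q) = deval h \<delta> \<tau> p - deval h \<delta> \<tau> q"
  using deval_add[of \<tau> "p - q" q] by simp

lemma deval_single: "deval h \<delta> \<tau> (Poly_Mapping.single m c) =
    h c * (\<Prod>v\<in>Poly_Mapping.keys m. ((\<delta> ^^ snd v) (\<tau> (fst v))) ^ Poly_Mapping.lookup m v)"
  by (subst deval_superset[where K = "{m}"]) auto

lemma deval_dconst: "deval h \<delta> \<tau> (dconst c) = h c"
  by (simp add: dconst_def deval_single)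

lemma deval_dvar: "deval h \<delta> \<tau> (dvar j k) = (\<delta> ^^ k) (\<tau> j)"
  by (simp add: dvar_def deval_single h_1)

lemma deval_scale: "deval h \<delta> \<tau> (dconst c * p) = h c * deval h \<delta> \<tau> p"
  using supported_UNIV[of p]
  by (induction rule: supported_induct)
     (simp_all add: deval_0 deval_single dconst_single h_mult mult.assoc distrib_left deval_add)

lemma deval_dp_deriv:
  "p \<in> affine_forms m \<Longrightarrow> deval h \<delta> \<tau> (dp_deriv d p) = \<delta> (deval h \<delta> \<tau> p)"
  by (induction rule: affine_induct)
     (simp_all add: d dp_deriv_dconst dp_deriv_add dp_deriv_scale dp_deriv_dvar
        deval_dconst deval_add deval_scale deval_dvar \<delta>_h \<delta>_add \<delta>_scale)

lemma deval_dp_deriv_pow: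
  "p \<in> affine_forms m \<Longrightarrow> deval h \<delta> \<tau> ((dp_deriv d ^^ k) p) = (\<delta> ^^ k) (deval h \<delta> \<tau> p)"
  by (induction k) (simp_all add: deval_dp_deriv[OF dp_deriv_pow_affine[OF d]])

lemma deval_cong:
  assumes "p \<in> affine_forms m" "\<And>j. j \<in> {1..m} \<Longrightarrow> \<sigma> j = \<tau> j"
  shows "deval h \<delta> \<sigma> p = deval h \<delta> \<tau> p"
  using assms(1)
  by (induction rule: affine_induct)
     (use assms(2) in \<open>simp_all add: deval_dconst deval_add deval_scale deval_dvar\<close>)

end

lemma dpoly_diff_algebra: "derivation d \<Longrightarrow> diff_algebra d dconst (dp_deriv d)"
  by unfold_locales
     (simp_all add: dconst_add dconst_mult dp_deriv_add dp_deriv_dconst dp_deriv_scale)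

lemma deval_affine:
  assumes "derivation d" "p \<in> affine_forms m" "\<And>j. j \<in> {1..m} \<Longrightarrow> G j \<in> affine_forms l"
  shows "deval dconst (dp_deriv d) G p \<in> affine_forms l"
proof -
  interpret D: diff_algebra d dconst "dp_deriv d" using assms(1) by (rule dpoly_diff_algebra)
  show ?thesis using assms(2)
    by (induction rule: affine_induct)
       (use assms in \<open>auto simp: D.deval_dconst D.deval_add D.deval_scale D.deval_dvar
         intro!: dconst_affine add_affine scale_affine dp_deriv_pow_affine\<close>)
qed

text \<open>
  Evaluating after a substitution is evaluating at the values of the substituted polynomials.
  This is what lets \<open>g(P(U)) = U\<close> be evaluated at arbitrary points.
\<close>

lemma (in diff_algebra) deval_deval:
  assumes "p \<in> affine_forms m" "\<And>j. j \<in> {1..m} \<Longrightarrow> G j \<in> affine_forms l"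
  shows "deval h \<delta> \<tau> (deval dconst (dp_deriv d) G p) = deval h \<delta> (\<lambda>j. deval h \<delta> \<tau> (G j)) p"
proof -
  interpret D: diff_algebra d dconst "dp_deriv d" using d by (rule dpoly_diff_algebra)
  show ?thesis using assms(1)
    by (induction rule: affine_induct)
       (use assms(2) in \<open>simp_all add: D.deval_dconst D.deval_add D.deval_scale D.deval_dvar
         deval_dconst deval_add deval_scale deval_dvar deval_dp_deriv_pow[of _ l]\<close>)
qed

section \<open>Solving a nonsingular system of linear forms\<close>

text \<open>
  The adjugate identity \<open>adj A \<sqdot> A = det A \<sqdot> 1\<close>, applied to the column vector of the variables,
  as in Cramer's rule. It is essential that the forms involve only the variables that head the
  columns, since otherwise the matrix would not determine them.
\<close>

lemma coordinate_as_combination_of_forms: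
  fixes f :: "nat \<Rightarrow> 'a::field dpoly" and cs :: "(nat \<times> nat) list"
  defines "A \<equiv> mat (length cs) (length cs) (\<lambda>(r, c). lin_coeff (f r) (cs ! c))"
  assumes "distinct cs" and lin: "\<And>r. r < length cs \<Longrightarrow> f r \<in> linear_forms (set cs)"
    and "det A \<noteq> 0" and "(j, k) \<in> set cs"
  shows "\<exists>b. dvar j k = (\<Sum>r<length cs. dconst (b r) * f r)"
proof -
  let ?s = "length cs"
  let ?x = "\<lambda>c. (case cs ! c of (j, k) \<Rightarrow> dvar j k) :: 'a dpoly"
  obtain c where c: "c < ?s" "cs ! c = (j, k)" using assms(5) by (metis in_set_conv_nth)
  have A: "A \<in> carrier_mat ?s ?s" by (simp add: A_def)
  have expand: "f r = (\<Sum>c'<?s. dconst (A $$ (r, c')) * ?x c')" if "r < ?s" for r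
  proof -
    have "f r = (\<Sum>v\<in>set cs. dconst (lin_coeff (f r) v) * (case v of (j, k) \<Rightarrow> dvar j k))"
      using linear_form_expansion[OF lin[OF that]] by (simp add: case_prod_unfold)
    also have "\<dots> = (\<Sum>c'<?s. dconst (lin_coeff (f r) (cs ! c')) * ?x c')"
      using \<open>distinct cs\<close>
      by (intro sum.reindex_bij_betw[symmetric] bij_betw_nth) auto
    finally show ?thesis using that by (simp add: A_def)
  qed
  have adj: "(\<Sum>r<?s. adj_mat A $$ (c, r) * A $$ (r, c')) = (if c' = c then det A else 0)"
    if "c' < ?s" for c'
  proof -
    have "(adj_mat A * A) $$ (c, c') = (det A \<cdot>\<^sub>m 1\<^sub>m ?s) $$ (c, c')"
      using adj_mat(3)[OF A] by simp
    moreover have "(adj_mat A * A) $$ (c, c') = (\<Sum>r<?s. adj_mat A $$ (c, r) * A $$ (r, c'))"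
      using c that A adj_mat(1)[OF A] by (auto simp: scalar_prod_def lessThan_atLeast0 intro!: sum.cong)
    ultimately show ?thesis using c that by auto
  qed
  have "(\<Sum>r<?s. dconst (adj_mat A $$ (c, r) / det A) * f r) =
      (\<Sum>r<?s. \<Sum>c'<?s. dconst (adj_mat A $$ (c, r) * A $$ (r, c') / det A) * ?x c')"
    by (intro sum.cong refl) (simp add: expand sum_distrib_left divide_inverse dconst_mult mult_ac)
  also have "\<dots> = (\<Sum>c'<?s. \<Sum>r<?s. dconst (adj_mat A $$ (c, r) * A $$ (r, c') / det A) * ?x c')"
    by (rule sum.swap)
  also have "\<dots> = (\<Sum>c'<?s. dconst ((\<Sum>r<?s. adj_mat A $$ (c, r) * A $$ (r, c')) / det A) * ?x c')"
  proof -
    have dsum: "dconst (sum g I) = (\<Sum>i\<in>I. dconst (g i))" for g :: "nat \<Rightarrow> 'a" and I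
      by (induction I rule: infinite_finite_induct) (simp_all add: dconst_add)
    show ?thesis by (simp add: sum_divide_distrib dsum sum_distrib_right)
  qed
  also have "\<dots> = (\<Sum>c'<?s. if c' = c then ?x c else 0)"
    using \<open>det A \<noteq> 0\<close> by (intro sum.cong refl) (simp add: adj)
  also have "\<dots> = dvar j k" using c by simp
  finally show ?thesis by metis
qed

section \<open>The shape of the resultant matrix\<close>

lemma distinct_concat_prod:
  assumes "distinct xs" "distinct ys"
  shows "distinct (concat (map (\<lambda>k. concat (map (\<lambda>j. if P j k then [(j, k)] else []) ys)) xs))"
proof -
  have "distinct (concat (map (\<lambda>j. if P j k then [(j, k)] else []) ys))" for k
    using assms(2) by (induction ys) auto
  then show ?thesis using assms(1) by (induction xs) auto
qed

lemma lin_coeff_hom_part: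
  assumes "j \<in> {1..n-1}"
  shows "lin_coeff (hom_part n \<L> i) (j, k) = coeff (\<L> i j) k"
proof -
  have "lin_coeff (lin_op_var (\<L> i j') j') (j, k) = (if j' = j then coeff (\<L> i j) k else 0)" for j'
    by (auto simp: lin_op_var_def lin_coeff_def lookup_sum dvar_term lookup_single when_def single_one_eq_iff
        not_le coeff_eq_0 simp del: One_nat_def)
  then show ?thesis using assms
    by (simp add: hom_part_def lin_coeff_def lookup_sum)
qed

lemma hom_part_linear: "hom_part n \<L> i \<in> linear_forms ({1..n-1} \<times> UNIV)"
  unfolding hom_part_def lin_op_var_def
  by (auto intro!: sum_supported scale_supported dvar_supported)

lemma finite_dvars: "finite (dvars p)"
  by (simp add: dvars_def)

lemma ord_in_ge:
  assumes "(j, k) \<in> dvars p"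
  shows "int k \<le> ord_in p j"
proof -
  have "{k. (j, k) \<in> dvars p} \<subseteq> snd ` dvars p" by force
  then have "finite {k. (j, k) \<in> dvars p}" by (rule finite_subset) (simp add: finite_dvars)
  then show ?thesis using assms by (auto simp: ord_in_def intro!: Max_ge)
qed

lemma linear_form_order_bound:
  assumes "p \<in> linear_forms (J \<times> UNIV)"
  shows "p \<in> linear_forms {(j, k). j \<in> J \<and> int k \<le> ord_in p j}"
proof -
  have "m \<in> var_monos {(j, k). j \<in> J \<and> int k \<le> ord_in p j}" if "m \<in> Poly_Mapping.keys p" for m
  proof -
    have "m \<in> var_monos (J \<times> UNIV)" using that assms by (auto simp: supported_on_def)
    then obtain j k where jk: "j \<in> J" "m = Poly_Mapping.single (j, k) 1"
      by (auto simp: var_monos_def)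
    then have "(j, k) \<in> dvars p" using that by (force simp: dvars_def)
    then show ?thesis using jk ord_in_ge by (auto simp: var_monos_def)
  qed
  then show ?thesis by (auto simp: supported_on_def)
qed

text \<open>
  The bounds are integers because the order is \<open>-1\<close> for an indeterminate that does not occur; the
  derivatives then get the bound \<open>r - 1\<close>. Though not sharp, this respects the column bounds, which
  are computed from the same convention.
\<close>

lemma dp_deriv_pow_order_bound:
  assumes "derivation d" "p \<in> linear_forms {(j, k). j \<in> J \<and> int k \<le> b j}"
  shows "(dp_deriv d ^^ r) p \<in> linear_forms {(j, k). j \<in> J \<and> int k \<le> b j + int r}"
  by (induction r) (use assms in \<open>auto intro: dp_deriv_linear\<close>)

lemma ord_in_le_max_ord:
  assumes "j \<in> {1..n-1}"
  shows "ord_in p j \<le> max_ord n p"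
  using assms by (auto simp: max_ord_def ord_in_def dvars_def intro: Max_ge)

lemma gamma_at_le: "i \<in> {1..n} \<Longrightarrow> gamma_at n H j \<le> max_ord n (H i) - ord_in (H i) j"
  unfolding gamma_at_def by (rule Min_le) auto

text \<open>
  This is \<open>\<gamma>\<^sub>j \<le> o\<^sub>i - ord(H\<^sub>i, u\<^sub>j)\<close> rewritten. It is used twice: it keeps the derivatives of
  \<open>H\<^sub>i\<close> within the columns of the matrix, and it limits the order of \<open>H\<^sub>i\<close> in a parameter
  that has no column.
\<close>

lemma order_plus_row_count_le_col_count:
  "i \<in> {1..n} \<Longrightarrow> ord_in (H i) j + row_count n H i \<le> col_count n H j"
  using gamma_at_le[of i n H j] by (simp add: row_count_def col_count_def)

lemma gamma_at_nonneg:
  assumes "j \<in> {1..n-1}" shows "gamma_at n H j \<ge> 0"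
  unfolding gamma_at_def
  using assms ord_in_le_max_ord[OF assms] by (subst Min_ge_iff) auto

lemma gamma_sum_nonneg: "gamma_sum n H \<ge> 0"
  unfolding gamma_sum_def by (rule sum_nonneg) (rule gamma_at_nonneg)

lemma set_res_cols: "set (res_cols n H) = {(j, k). j \<in> {1..n-1} \<and> int k < col_count n H j}"
proof -
  have "k < nat (ord_sum n H)" if "j \<in> {1..n-1}" "int k < col_count n H j" for j k
    using that gamma_at_nonneg[of j n H] gamma_sum_nonneg[of n H] by (simp add: col_count_def)
  then show ?thesis by (fastforce simp: res_cols_def)
qed

lemma distinct_res_cols: "distinct (res_cols n H)"
  unfolding res_cols_def by (rule distinct_concat_prod) auto

lemma sum_nat_eq_nat_sum:
  "(\<And>i. i \<in> I \<Longrightarrow> f i \<ge> 0) \<Longrightarrow> (\<Sum>i\<in>I. nat (f i)) = nat (\<Sum>i\<in>I. f i)"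
  by (induction I rule: infinite_finite_induct) (auto simp: nat_add_distrib sum_nonneg)

lemma length_res_rows:
  assumes "\<And>i. i \<in> {1..n} \<Longrightarrow> row_count n H i \<ge> 0"
  shows "length (res_rows n H) = res_size n H"
proof -
  have "length (res_rows n H) = (\<Sum>i\<in>{1..n}. nat (row_count n H i))"
    by (simp add: res_rows_def length_concat comp_def interv_sum_list_conv_sum_set_nat
        atLeastLessThanSuc_atLeastAtMost del: upt_Suc)
  also have "\<dots> = res_size n H"
    unfolding res_size_def by (rule sum_nat_eq_nat_sum) (rule assms)
  finally show ?thesis .
qed

text \<open>
  The numbers of rows and columns agree because \<open>(n - 1) N - \<gamma> - (n - 1) \<gamma> = n N - N - n \<gamma>\<close>.
\<close>

lemma length_res_cols:
  assumes "n \<ge> 2"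
    and "\<And>j. j \<in> {1..n-1} \<Longrightarrow> col_count n H j \<ge> 0"
  shows "length (res_cols n H) = res_size n H"
proof -
  have "length (res_cols n H) = card (set (res_cols n H))"
    by (simp add: distinct_card distinct_res_cols)
  also have "set (res_cols n H) = (SIGMA j:{1..n-1}. {..<nat (col_count n H j)})"
    by (auto simp: set_res_cols)
  also have "card \<dots> = (\<Sum>j\<in>{1..n-1}. nat (col_count n H j))" by simp
  also have "\<dots> = nat (\<Sum>j\<in>{1..n-1}. col_count n H j)"
    by (rule sum_nat_eq_nat_sum) (rule assms(2))
  also have "(\<Sum>j\<in>{1..n-1}. col_count n H j) = (\<Sum>i\<in>{1..n}. row_count n H i)"
  proof -
    have "(\<Sum>j\<in>{1..n-1}. col_count n H j) = int (n - 1) * (ord_sum n H - gamma_sum n H) - gamma_sum n H"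
      unfolding col_count_def sum_subtractf gamma_sum_def[symmetric] by (simp add: algebra_simps)
    moreover have "(\<Sum>i\<in>{1..n}. row_count n H i) = int n * (ord_sum n H - gamma_sum n H) - ord_sum n H"
      unfolding row_count_def sum_subtractf ord_sum_def[symmetric] by (simp add: algebra_simps)
    ultimately show ?thesis using \<open>n \<ge> 2\<close> by (simp add: of_nat_diff algebra_simps)
  qed
  finally show ?thesis by (simp add: res_size_def)
qed

section \<open>Recovering the parameters\<close>

definition recoverable :: "('k::field \<Rightarrow> 'k) \<Rightarrow> nat \<Rightarrow> (nat \<Rightarrow> 'k dpoly) \<Rightarrow> 'k dpoly set" where
  "recoverable d n P = deval dconst (dp_deriv d) P ` affine_forms n"

context
  fixes d :: "'k::field \<Rightarrow> 'k" and n :: nat and P :: "nat \<Rightarrow> 'k dpoly"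
  assumes d: "derivation d"
begin

interpretation D: diff_algebra d dconst "dp_deriv d" using d by (rule dpoly_diff_algebra)

lemma recoverable_dconst: "dconst c \<in> recoverable d n P"
  unfolding recoverable_def by (rule image_eqI[OF _ dconst_affine]) (simp add: D.deval_dconst)

lemma recoverable_equation: "i \<in> {1..n} \<Longrightarrow> P i \<in> recoverable d n P"
  unfolding recoverable_def by (rule image_eqI[OF _ dvar_affine[of _ _ 0]]) (simp_all add: D.deval_dvar)

lemma recoverable_add:
  "p \<in> recoverable d n P \<Longrightarrow> q \<in> recoverable d n P \<Longrightarrow> p + q \<in> recoverable d n P"
  unfolding recoverable_def by (elim imageE) (metis D.deval_add add_affine imageI)

lemma recoverable_diff:
  "p \<in> recoverable d n P \<Longrightarrow> q \<in> recoverable d n P \<Longrightarrow> p - q \<in> recoverable d n P"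
  unfolding recoverable_def by (elim imageE) (metis D.deval_diff diff_affine imageI)

lemma recoverable_scale: "p \<in> recoverable d n P \<Longrightarrow> dconst c * p \<in> recoverable d n P"
  unfolding recoverable_def by (elim imageE) (metis D.deval_scale scale_affine imageI)

lemma recoverable_sum: "(\<And>i. i \<in> I \<Longrightarrow> f i \<in> recoverable d n P) \<Longrightarrow> sum f I \<in> recoverable d n P"
  by (induction I rule: infinite_finite_induct)
     (use recoverable_dconst[of 0] in \<open>auto intro: recoverable_add\<close>)

lemma recoverable_dp_deriv_pow: "p \<in> recoverable d n P \<Longrightarrow> (dp_deriv d ^^ k) p \<in> recoverable d n P"
  unfolding recoverable_def
  by (elim imageE) (metis D.deval_dp_deriv_pow dp_deriv_pow_affine[OF d] imageI)

end

text \<open>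
  The parameters with a column are obtained from the nonsingular matrix. The remaining parameter is
  obtained afterwards, as this uses that all the others are recoverable.
\<close>

lemma recoverable_parameters:
  fixes d :: "'k::field \<Rightarrow> 'k" and \<L> :: "nat \<Rightarrow> nat \<Rightarrow> 'k poly"
  assumes d: "derivation d" and n: "n \<ge> 2" and H: "H = hom_part n \<L>"
    and P: "\<And>i. i \<in> {1..n} \<Longrightarrow> P i = dconst (a i) - H i"
    and occurs: "\<And>j. j \<in> {1..n-1} \<Longrightarrow> \<exists>i\<in>{1..n}. \<L> i j \<noteq> 0"
    and rows: "\<And>i. i \<in> {1..n} \<Longrightarrow> row_count n H i \<ge> 0"
    and cols: "card {j \<in> {1..n-1}. col_count n H j < 1} \<le> 1"
    and res: "dCRes_h d n H \<noteq> 0"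
    and j: "j \<in> {1..n-1}"
  shows "dvar j 0 \<in> recoverable d n P"
proof -
  let ?R = "recoverable d n P"
  have H_R: "H i \<in> ?R" if "i \<in> {1..n}" for i
  proof -
    have "dconst (a i) - P i \<in> ?R"
      using that d by (intro recoverable_diff recoverable_dconst recoverable_equation)
    then show ?thesis using P[OF that] by simp
  qed
  have ord_coeff: "int k \<le> ord_in (H i) j" if "j \<in> {1..n-1}" "coeff (\<L> i j) k \<noteq> 0" for i j k
  proof (rule ord_in_ge)
    have "Poly_Mapping.single (j, k) 1 \<in> Poly_Mapping.keys (H i)"
      using that lin_coeff_hom_part[of j n \<L> i k] by (simp add: lin_coeff_def in_keys_iff H)
    then show "(j, k) \<in> dvars (H i)" by (force simp: dvars_def)
  qed
  have col_nonneg: "col_count n H j \<ge> 0" if j: "j \<in> {1..n-1}" for j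
  proof -
    obtain i where i: "i \<in> {1..n}" "\<L> i j \<noteq> 0" using occurs[OF j] by blast
    then have "int (degree (\<L> i j)) \<le> ord_in (H i) j" using ord_coeff[OF j] by simp
    then show ?thesis
      using order_plus_row_count_le_col_count[OF i(1), of H j] rows[OF i(1)] by linarith
  qed
  have len: "length (res_cols n H) = res_size n H" "length (res_rows n H) = res_size n H"
    using length_res_cols[OF n col_nonneg] length_res_rows[OF rows] by auto
  define f where "f r = (case res_rows n H ! r of (i, k) \<Rightarrow> (dp_deriv d ^^ k) (H i))" for r
  have row: "f r \<in> linear_forms (set (res_cols n H)) \<and> f r \<in> ?R" if "r < res_size n H" for r
  proof -
    obtain i k where ik: "res_rows n H ! r = (i, k)" by force
    then have "(i, k) \<in> set (res_rows n H)" using that len by (metis nth_mem)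
    then have i: "i \<in> {1..n}" "int k < row_count n H i" by (auto simp: res_rows_def)
    have "(dp_deriv d ^^ k) (H i) \<in>
        linear_forms {(j, k'). j \<in> {1..n-1} \<and> int k' \<le> ord_in (H i) j + int k}"
      unfolding H by (intro dp_deriv_pow_order_bound[OF d] linear_form_order_bound hom_part_linear)
    moreover have "{(j, k'). j \<in> {1..n-1} \<and> int k' \<le> ord_in (H i) j + int k} \<subseteq> set (res_cols n H)"
    proof (clarsimp simp: set_res_cols)
      fix j k' assume "int k' \<le> ord_in (H i) j + int k"
      then show "int k' < col_count n H j"
        using i order_plus_row_count_le_col_count[OF i(1), of H j] by linarith
    qed
    ultimately show ?thesis
      using supported_on_mono[OF var_monos_mono] recoverable_dp_deriv_pow[OF d H_R[OF i(1)]]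
      by (auto simp: f_def ik)
  qed
  have mat_eq: "mat (res_size n H) (res_size n H) (\<lambda>(r, c). lin_coeff (f r) (res_cols n H ! c)) =
      res_matrix d n H"
    unfolding res_matrix_def f_def by (intro cong_mat) (auto split: prod.splits)
  have column: "dvar j k \<in> ?R" if "j \<in> {1..n-1}" "int k < col_count n H j" for j k
  proof -
    have "(j, k) \<in> set (res_cols n H)" using that by (simp add: set_res_cols)
    then have "\<exists>b. dvar j k = (\<Sum>r<res_size n H. dconst (b r) * f r)"
      unfolding len(1)[symmetric] using row res
      by (intro coordinate_as_combination_of_forms distinct_res_cols)
         (simp_all add: len mat_eq dCRes_h_def)
    then obtain b where "dvar j k = (\<Sum>r<res_size n H. dconst (b r) * f r)" ..
    moreover have "(\<Sum>r<res_size n H. dconst (b r) * f r) \<in> ?R"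
      using row by (intro recoverable_sum[OF d] recoverable_scale[OF d]) simp
    ultimately show ?thesis by simp
  qed
  show ?thesis
  proof (cases "col_count n H j \<ge> 1")
    case True
    then show ?thesis using column[OF j, of 0] by simp
  next
    \<comment> \<open>No column belongs to the parameter, so it has to be solved for in an equation where it occurs.\<close>
    case False
    obtain i where i: "i \<in> {1..n}" "\<L> i j \<noteq> 0" using occurs[OF j] by blast
    have "int (degree (\<L> i j)) \<le> ord_in (H i) j" using i ord_coeff[OF j] by simp
    then have deg: "degree (\<L> i j) = 0"
      using False order_plus_row_count_le_col_count[OF i(1), of H j] rows[OF i(1)] by linarith
    define c where "c = coeff (\<L> i j) 0"
    have c: "c \<noteq> 0" using i deg by (metis c_def leading_coeff_0_iff)
    have other: "dvar j' k \<in> ?R" if j': "j' \<in> {1..n-1}" "j' \<noteq> j" for j' k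
    proof -
      have "col_count n H j' \<ge> 1"
      proof (rule ccontr)
        assume "\<not> col_count n H j' \<ge> 1"
        then have "{j, j'} \<subseteq> {j \<in> {1..n-1}. col_count n H j < 1}" using False j j' by auto
        then have "card {j, j'} \<le> card {j \<in> {1..n-1}. col_count n H j < 1}" by (intro card_mono) auto
        then show False using cols j' by simp
      qed
      then have "(dp_deriv d ^^ k) (dvar j' 0) \<in> ?R"
        using column[OF j'(1), of 0] by (intro recoverable_dp_deriv_pow[OF d]) simp
      then show ?thesis by (simp add: dp_deriv_pow_dvar d)
    qed
    have "H i = lin_op_var (\<L> i j) j + (\<Sum>j'\<in>{1..n-1} - {j}. lin_op_var (\<L> i j') j')"
      using j by (simp add: H hom_part_def sum.remove)
    moreover have "lin_op_var (\<L> i j) j = dconst c * dvar j 0"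
      by (simp add: lin_op_var_def deg c_def)
    moreover have "(\<Sum>j'\<in>{1..n-1} - {j}. lin_op_var (\<L> i j') j') \<in> ?R"
      using other unfolding lin_op_var_def
      by (intro recoverable_sum[OF d] recoverable_scale[OF d]) auto
    ultimately have "dconst c * dvar j 0 \<in> ?R"
      using recoverable_diff[OF d H_R[OF i(1)]] by fastforce
    then have "dconst (inverse c) * (dconst c * dvar j 0) \<in> ?R" by (rule recoverable_scale[OF d])
    moreover have "dconst (inverse c) * (dconst c * dvar j 0) = dvar j 0"
      unfolding mult.assoc[symmetric] dconst_mult[symmetric] using c by simp
    ultimately show ?thesis by simp
  qed
qed

section \<open>Properness from inversion maps\<close>

text \<open>
  Existence is where genericity of \<open>\<Gamma>\<close> enters: the relations \<open>x\<^sub>i = P\<^sub>i(g)\<close> hold at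
  \<open>X = P(U)\<close>, hence at every generic zero. Uniqueness holds for every point of the form \<open>P(\<tau>)\<close>.
\<close>

lemma proper_if_inversion_maps:
  assumes d: "derivation d" and E: "diff_algebra d \<iota> dE"
    and P: "\<And>i. i \<in> {1..n} \<Longrightarrow> P i \<in> affine_forms (n - 1)"
    and g: "\<And>j. j \<in> {1..n-1} \<Longrightarrow> g j \<in> affine_forms n"
      "\<And>j. j \<in> {1..n-1} \<Longrightarrow> deval dconst (dp_deriv d) P (g j) = dvar j 0"
  shows "proper_dppes d dE \<iota> n P"
proof -
  interpret D: diff_algebra d dconst "dp_deriv d" using d by (rule dpoly_diff_algebra)
  interpret E: diff_algebra d \<iota> dE by (rule E)
  show ?thesis
    unfolding proper_dppes_def
  proof (intro allI impI)
    fix \<Gamma>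
    assume \<Gamma>: "generic_zero dE \<iota> n (implicit_ideal d n P) \<Gamma>"
    define \<tau> where "\<tau> = restrict (\<lambda>j. deval \<iota> dE \<Gamma> (g j)) {1..n-1}"
    show "\<exists>!\<tau>. \<tau> \<in> {1..n-1} \<rightarrow>\<^sub>E UNIV \<and> (\<forall>i\<in>{1..n}. \<Gamma> i = deval \<iota> dE \<tau> (P i))"
    proof (rule ex1I[of _ \<tau>], intro conjI ballI)
      fix i assume i: "i \<in> {1..n}"
      \<comment> \<open>The polynomial \<open>x\<^sub>i - P\<^sub>i(g)\<close>, a member of the implicit ideal.\<close>
      define s where "s = dvar i 0 - deval dconst (dp_deriv d) g (P i)"
      have "deval dconst (dp_deriv d) P (deval dconst (dp_deriv d) g (P i)) =
          deval dconst (dp_deriv d) (\<lambda>j. deval dconst (dp_deriv d) P (g j)) (P i)"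
        by (rule D.deval_deval[OF P[OF i] g(1)])
      also have "\<dots> = deval dconst (dp_deriv d) (\<lambda>j. dvar j 0) (P i)"
        using g(2) by (intro D.deval_cong[OF P[OF i]])
      also have "\<dots> = P i"
        using P[OF i] by (induction rule: affine_induct)
          (simp_all add: D.deval_dconst D.deval_add D.deval_scale D.deval_dvar dp_deriv_pow_dvar d)
      finally have "deval dconst (dp_deriv d) P s = 0"
        by (simp add: s_def D.deval_diff D.deval_dvar)
      moreover have s: "s \<in> affine_forms n"
        unfolding s_def by (intro diff_affine dvar_affine i deval_affine[OF d P[OF i] g(1)])
      ultimately have "s \<in> implicit_ideal d n P"
        by (simp add: implicit_ideal_def affine_dpolys)
      then have "deval \<iota> dE \<Gamma> s = 0" using \<Gamma> by (auto simp: generic_zero_def)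
      then have "\<Gamma> i = deval \<iota> dE \<Gamma> (deval dconst (dp_deriv d) g (P i))"
        by (simp add: s_def E.deval_diff E.deval_dvar)
      also have "\<dots> = deval \<iota> dE (\<lambda>j. deval \<iota> dE \<Gamma> (g j)) (P i)"
        by (rule E.deval_deval[OF P[OF i] g(1)])
      also have "\<dots> = deval \<iota> dE \<tau> (P i)"
        by (intro E.deval_cong[OF P[OF i]]) (simp add: \<tau>_def)
      finally show "\<Gamma> i = deval \<iota> dE \<tau> (P i)" .
    next
      fix \<sigma>
      assume \<sigma>: "\<sigma> \<in> {1..n-1} \<rightarrow>\<^sub>E UNIV \<and> (\<forall>i\<in>{1..n}. \<Gamma> i = deval \<iota> dE \<sigma> (P i))"
      have "\<sigma> j = \<tau> j" if j: "j \<in> {1..n-1}" for j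
      proof -
        have "\<tau> j = deval \<iota> dE \<Gamma> (g j)" using j by (simp add: \<tau>_def)
        also have "\<dots> = deval \<iota> dE (\<lambda>i. deval \<iota> dE \<sigma> (P i)) (g j)"
          using \<sigma> by (intro E.deval_cong[OF g(1)[OF j]]) auto
        also have "\<dots> = deval \<iota> dE \<sigma> (deval dconst (dp_deriv d) P (g j))"
          by (rule E.deval_deval[OF g(1)[OF j] P, symmetric])
        also have "\<dots> = \<sigma> j" using g(2)[OF j] by (simp add: E.deval_dvar)
        finally show ?thesis by simp
      qed
      then show "\<sigma> = \<tau>" using \<sigma> by (intro PiE_ext[of \<sigma> "{1..n-1}" "\<lambda>_. UNIV"]) (auto simp: \<tau>_def)
    qed (simp add: \<tau>_def)
  qed
qed

lemma universal_extension_diff_algebra: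
  assumes "derivation d" "universal_extension d dE \<iota>"
  shows "diff_algebra d \<iota> dE"
proof -
  have dE: "derivation dE" and hom: "field_hom \<iota>" and comm: "\<And>x. \<iota> (d x) = dE (\<iota> x)"
    using assms(2) by (auto simp: universal_extension_def diff_field_hom_def)
  interpret field_hom \<iota> by (rule hom)
  show ?thesis
    by unfold_locales
       (simp_all add: assms(1) hom_add hom_mult derivation_add[OF dE] derivation_mult[OF dE] comm)
qed

section \<open>Nonvanishing resultant\<close>

theorem proposition7p1:
  fixes d :: "'k::field \<Rightarrow> 'k"
    and dE :: "'e::field \<Rightarrow> 'e"
    and \<iota> :: "'k \<Rightarrow> 'e"
    and u :: "nat \<Rightarrow> 'e"
    and n :: nat
    and P H :: "nat \<Rightarrow> 'k dpoly"
    and a :: "nat \<Rightarrow> 'k"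
    and \<L> :: "nat \<Rightarrow> nat \<Rightarrow> 'k poly"
  assumes "derivation d"
    and "universal_extension d dE \<iota>"
    and "n \<ge> 2"
    and "diff_alg_independent dE \<iota> (n - 1) u"
    and "linear_dppes n P"
    and "H = hom_part n \<L>"
    and "\<And>i. i \<in> {1..n} \<Longrightarrow> P i = dconst (a i) - H i"
    and "\<And>j. j \<in> {1..n-1} \<Longrightarrow> \<exists>i\<in>{1..n}. \<L> i j \<noteq> 0"
    and rows: "\<And>i. i \<in> {1..n} \<Longrightarrow> row_count n H i \<ge> 0"
    and cols: "card {j \<in> {1..n-1}. col_count n H j < 1} \<le> 1"
    and "dCRes_h d n H \<noteq> 0"
  shows "proper_dppes d dE \<iota> n P \<and> (\<exists>g. linear_inversion_maps d n P g)"
proof -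
  have "\<exists>g\<in>affine_forms n. deval dconst (dp_deriv d) P g = dvar j 0" if "j \<in> {1..n-1}" for j
  proof -
    have "dvar j 0 \<in> recoverable d n P"
      by (rule recoverable_parameters[OF assms(1,3,6,7,8) rows cols assms(11) that])
    then show ?thesis unfolding recoverable_def by (metis imageE)
  qed
  then obtain g where g: "\<And>j. j \<in> {1..n-1} \<Longrightarrow> g j \<in> affine_forms n"
    "\<And>j. j \<in> {1..n-1} \<Longrightarrow> deval dconst (dp_deriv d) P (g j) = dvar j 0"
    by metis
  have "P i \<in> affine_forms (n - 1)" if "i \<in> {1..n}" for i
  proof -
    have "H i \<in> affine_forms (n - 1)"
      unfolding assms(6) affine_forms_def
      using hom_part_linear supported_on_mono by blast
    then show ?thesis using assms(7)[OF that] by (simp add: diff_affine dconst_affine)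
  qed
  then have "proper_dppes d dE \<iota> n P"
    using proper_if_inversion_maps[OF assms(1) universal_extension_diff_algebra[OF assms(1,2)] _ g]
    by blast
  moreover have "linear_inversion_maps d n P g"
    unfolding linear_inversion_maps_def using g affine_dpolys total_degree_affine by blast
  ultimately show ?thesis by blast
qed

end
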